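(* Let $G$ be a graph, $S\subseteq V(G)$, $f:S\to\mathbb{N}$ with $f(s)\geq 1$ for all $s\in S$, and let $M=M(S,f)$ be the multiset with support $S$ and multiplicities $f$. Let $\mathfrak{R}_2:=\{f(S'): S'\subseteq S,\ |S'|\geq 2\}$, where $f(S')=\sum_{s\in S'}f(s)$. For any collection of integers $\{c_i: i\in\mathfrak{R}_2\}$ there exists a graph $G'$ containing $G$ as an induced subgraph such that $\mathcal{E}(G';M,q)[q^k]=c_k$ for all $k\in\mathfrak{R}_2$.
   Context: Graphs are finite and simple; $N[X]$ is the closed neighborhood of $X$. Power domination process on a graph $H$ from $T\subseteq V(H)$: set $B:=N[T]$; then, while some $x\in B$ has exactly one vertex $y$ of $N[x]$ outside $B$, add $y$ to $B$. The final set is $\mathrm{Obs}(H;T)$ (with $\mathrm{Obs}(H;\emptyset)=\emptyset$). For a multiset placement $M=M(S,f)$ (multiplicity $f(s)$ at $s$, each of the $f(s)$ sensors failing independently with probability $q\in[0,1]$), the expected value polynomial is $\mathcal{E}(H;M,q)=\sum_{S'\subseteq S}|\mathrm{Obs}(H;S')|\,q^{f(S\setminus S')}\prod_{s\in S'}(1-q^{f(s)})$, the expected number of observed vertices. For a polynomial $p$ in $q$, $p[q^j]$ denotes the coefficient of $q^j$. *)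

theory Defs
  imports
    "Graph_Theory.Graph_Theory"
    "HOL-Library.Multiset"
    "HOL-Computational_Algebra.Polynomial"
begin

text \<open>
  A finite simple graph is a \<^locale>\<open>pair_graph\<close>: a finite vertex set with a symmetric,
  irreflexive arc relation.
\<close>

definition closed_nbhd :: "'a pair_pre_digraph \<Rightarrow> 'a set \<Rightarrow> 'a set" where
  "closed_nbhd H X = X \<union> parcs H `` X"

definition pd_step :: "'a pair_pre_digraph \<Rightarrow> 'a set \<Rightarrow> 'a set \<Rightarrow> bool" where
  "pd_step H B B' \<longleftrightarrow>
     (\<exists>x\<in>B. \<exists>y. closed_nbhd H {x} - B = {y} \<and> B' = insert y B)"

definition pd_outcome :: "'a pair_pre_digraph \<Rightarrow> 'a set \<Rightarrow> 'a set \<Rightarrow> bool" where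
  "pd_outcome H T B \<longleftrightarrow>
     (pd_step H)\<^sup>*\<^sup>* (closed_nbhd H T) B \<and> \<not> (\<exists>B'. pd_step H B B')"

text \<open>
  The forcing vertices may be chosen in any order; \<open>pd_outcome_ex1\<close> below shows that the
  process terminates and that its final set does not depend on these choices.
\<close>

definition Obs :: "'a pair_pre_digraph \<Rightarrow> 'a set \<Rightarrow> 'a set" where
  "Obs H T = (THE B. pd_outcome H T B)"

text \<open>
  The expected value polynomial in the indeterminate \<open>q\<close>: the support of \<open>M\<close> is
  \<^term>\<open>set_mset M\<close>, the multiplicity of \<open>s\<close> is \<^term>\<open>count M s\<close>, and
  \<^term>\<open>monom 1 n\<close> is \<open>q\<close> to the power \<open>n\<close>.
\<close>

definition expected_poly :: "'a pair_pre_digraph \<Rightarrow> 'a multiset \<Rightarrow> int poly" where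
  "expected_poly H M =
     (\<Sum>S' \<in> Pow (set_mset M).
        of_nat (card (Obs H S')) * monom 1 (\<Sum>s\<in>set_mset M - S'. count M s)
          * (\<Prod>s\<in>S'. 1 - monom 1 (count M s)))"

definition R2 :: "'a set \<Rightarrow> ('a \<Rightarrow> nat) \<Rightarrow> nat set" where
  "R2 S f = {sum f S' |S'. S' \<subseteq> S \<and> card S' \<ge> 2}"

lemma pd_reach_subset_terminal:
  assumes "(pd_step H)\<^sup>*\<^sup>* B0 B" and "B0 \<subseteq> C" and "\<not> (\<exists>C'. pd_step H C C')"
  shows "B \<subseteq> C"
  using assms(1)
proof (induction rule: rtranclp_induct)
  case base
  then show ?case using assms(2) .
next
  case (step B B')
  then obtain x y where xy: "x \<in> B" "closed_nbhd H {x} - B = {y}" "B' = insert y B"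
    by (auto simp: pd_step_def)
  have "y \<in> C"
  proof (rule ccontr)
    assume "y \<notin> C"
    with xy step.IH have "closed_nbhd H {x} - C = {y}" "x \<in> C" by blast+
    with assms(3) show False by (auto simp: pd_step_def)
  qed
  with xy step.IH show ?case by simp
qed

lemma pd_reach_supset: "(pd_step H)\<^sup>*\<^sup>* B0 B \<Longrightarrow> B0 \<subseteq> B"
  by (induction rule: rtranclp_induct) (auto simp: pd_step_def)

lemma pd_terminal_ex:
  assumes "finite V" and "parcs H \<subseteq> V \<times> V" and "B \<subseteq> V"
  shows "\<exists>C. (pd_step H)\<^sup>*\<^sup>* B C \<and> \<not> (\<exists>C'. pd_step H C C')"
  using assms(3)
proof (induction "card (V - B)" arbitrary: B rule: less_induct)
  case less
  show ?case
  proof (cases "\<exists>B'. pd_step H B B'")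
    case True
    then obtain x y where xy: "x \<in> B" "closed_nbhd H {x} - B = {y}"
        and st: "pd_step H B (insert y B)"
      by (auto simp: pd_step_def)
    from xy(2) have y: "y \<notin> B" "y \<in> closed_nbhd H {x}"
      by (metis DiffD2 insertI1, metis DiffD1 insertI1)
    with xy(1) have "(x, y) \<in> parcs H"
      by (auto simp: closed_nbhd_def)
    with assms(2) have "y \<in> V"
      by auto
    with y have "card (V - insert y B) < card (V - B)"
      using assms(1) by (intro psubset_card_mono) auto
    then obtain C where "(pd_step H)\<^sup>*\<^sup>* (insert y B) C" "\<not> (\<exists>C'. pd_step H C C')"
      using less.hyps \<open>y \<in> V\<close> less.prems by (metis insert_subset)
    with st show ?thesis by (meson converse_rtranclp_into_rtranclp)
  qed blast
qed

lemma pd_outcome_ex1: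
  assumes "pair_graph H" and "T \<subseteq> pverts H"
  shows "\<exists>!B. pd_outcome H T B"
proof -
  interpret pair_graph H by fact
  have arcs: "parcs H \<subseteq> pverts H \<times> pverts H"
    by (auto dest: in_arcsD1 in_arcsD2)
  then have "closed_nbhd H T \<subseteq> pverts H"
    using assms(2) by (auto simp: closed_nbhd_def)
  with pd_terminal_ex[OF pair_finite_verts arcs] have "\<exists>B. pd_outcome H T B"
    by (auto simp: pd_outcome_def)
  moreover have "B \<subseteq> C" if "pd_outcome H T B" "pd_outcome H T C" for B C
    using that pd_reach_subset_terminal pd_reach_supset unfolding pd_outcome_def by metis
  ultimately show ?thesis by blast
qed

lemma pd_outcome_Obs:
  "pair_graph H \<Longrightarrow> T \<subseteq> pverts H \<Longrightarrow> pd_outcome H T (Obs H T)"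
  unfolding Obs_def by (rule theI') (rule pd_outcome_ex1)

end

theory Submission
  imports Defs
begin

text \<open>
  Hanging two private leaves on every \<open>s \<in> S\<close> prevents the vertices of \<open>S\<close> that carry no working
  sensor from ever forcing. A gadget of new vertices whose only old neighbours lie in \<open>S\<close> then leaves
  the rest of the process untouched, so its contribution to the expected value is additive.
  One family of gadgets contributes \<open>1 - q^f(A)\<close>, another contributes
  \<open>3 - 2 q^f(A) - 2 q^f(a) + q^(f(A) + f(a))\<close> for \<open>a \<notin> A\<close>. They move the coefficient of \<open>q^k\<close> by
  \<open>-1\<close> and \<open>+1\<close> without changing any higher coefficient, so the coefficients can be adjusted
  one after another, starting from the largest \<open>k\<close>.
\<close>

section \<open>Extending a graph by new vertices\<close>

definition extend_graph :: "'a pair_pre_digraph \<Rightarrow> 'a set \<Rightarrow> 'a rel \<Rightarrow> 'a pair_pre_digraph" where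
  "extend_graph H W E = \<lparr>pverts = pverts H \<union> W, parcs = parcs H \<union> E \<union> E\<inverse>\<rparr>"

lemma extend_graph_sel [simp]:
  "pverts (extend_graph H W E) = pverts H \<union> W"
  "parcs (extend_graph H W E) = parcs H \<union> E \<union> E\<inverse>"
  by (simp_all add: extend_graph_def)

lemma pair_graph_arcs_subset: "pair_graph H \<Longrightarrow> parcs H \<subseteq> pverts H \<times> pverts H"
proof -
  assume "pair_graph H"
  then interpret pair_graph H .
  show ?thesis by (auto dest: in_arcsD1 in_arcsD2)
qed

lemma pair_graph_sym: "pair_graph H \<Longrightarrow> (u, v) \<in> parcs H \<Longrightarrow> (v, u) \<in> parcs H"
proof -
  assume "pair_graph H" and uv: "(u, v) \<in> parcs H"
  then interpret pair_graph H by simp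
  show ?thesis using pair_sym_arcs uv by (auto simp: symmetric_def elim: symE)
qed

lemma pair_graph_finite_verts: "pair_graph H \<Longrightarrow> finite (pverts H)"
  by (simp add: pair_fin_digraph.pair_finite_verts pair_digraph_def pair_graph_def)

lemma pair_graph_extend:
  assumes "pair_graph H" "finite W" "E \<subseteq> (pverts H \<union> W) \<times> W" "irrefl E"
  shows "pair_graph (extend_graph H W E)"
proof -
  interpret pair_graph H by fact
  have fin: "finite E"
    using assms(2,3) pair_finite_verts by (meson finite_SigmaI finite_UnI finite_subset)
  show ?thesis
  proof
    show "finite (pverts (extend_graph H W E))" "finite (parcs (extend_graph H W E))"
      using assms(2) fin pair_finite_verts pair_finite_arcs by auto
    show "symmetric (with_proj (extend_graph H W E))"
      using pair_graph_sym[OF assms(1)] by (auto simp: symmetric_def intro!: symI)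
    show "fst e \<noteq> snd e" if "e \<in> parcs (extend_graph H W E)" for e
      using that pair_no_loops[of e] assms(4) by (cases e) (auto simp: irrefl_def)
    show "fst e \<in> pverts (extend_graph H W E)" "snd e \<in> pverts (extend_graph H W E)"
      if "e \<in> parcs (extend_graph H W E)" for e
      using that assms(3) arc_fst_in_verts arc_snd_in_verts by auto
  qed
qed

text \<open>Every arc of \<open>E\<close> ends in \<open>W\<close>, which is disjoint from the old
  vertices, so no arc between two old vertices is added.\<close>

lemma induced_subgraph_extend:
  assumes "pair_graph H" "finite W" "E \<subseteq> (pverts H \<union> W) \<times> W" "irrefl E" "W \<inter> pverts H = {}"
  shows "induced_subgraph (with_proj H) (with_proj (extend_graph H W E))"
proof -
  interpret H: pair_graph H by fact
  interpret H': pair_graph "extend_graph H W E" by (rule pair_graph_extend) fact+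
  show ?thesis
    unfolding induced_subgraph_def subgraph_def compatible_def
    using H.wf_digraph_axioms H'.wf_digraph_axioms pair_graph_arcs_subset[OF assms(1)] assms(3,5)
    by auto
qed

lemma induced_subgraph_trans:
  "induced_subgraph G H \<Longrightarrow> induced_subgraph H K \<Longrightarrow> induced_subgraph G K"
  unfolding induced_subgraph_def subgraph_def compatible_def by auto

section \<open>The observed set as a least terminal set\<close>

lemma closed_nbhd_subset: "v \<in> T \<Longrightarrow> closed_nbhd H {v} \<subseteq> closed_nbhd H T"
  by (auto simp: closed_nbhd_def)

definition terminal :: "'a pair_pre_digraph \<Rightarrow> 'a set \<Rightarrow> bool" where
  "terminal H B \<longleftrightarrow> (\<forall>x\<in>B. \<forall>y. closed_nbhd H {x} - B \<noteq> {y})"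

lemma terminal_iff: "terminal H B \<longleftrightarrow> \<not> (\<exists>B'. pd_step H B B')"
  by (auto simp: terminal_def pd_step_def)

context
  fixes H :: "'a pair_pre_digraph" and T :: "'a set"
  assumes H: "pair_graph H" and T: "T \<subseteq> pverts H"
begin

lemma closed_nbhd_Obs: "closed_nbhd H T \<subseteq> Obs H T"
  using pd_outcome_Obs[OF H T] pd_reach_supset by (auto simp: pd_outcome_def)

lemma terminal_Obs: "terminal H (Obs H T)"
  using pd_outcome_Obs[OF H T] by (simp add: pd_outcome_def terminal_iff)

text \<open>With \<open>closed_nbhd_Obs\<close> and \<open>terminal_Obs\<close> this characterizes
  \<open>Obs H T\<close> by minimality. Observed sets are computed from these three facts, without
  following a forcing order.\<close>

lemma Obs_least: "closed_nbhd H T \<subseteq> C \<Longrightarrow> terminal H C \<Longrightarrow> Obs H T \<subseteq> C"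
  using pd_outcome_Obs[OF H T] pd_reach_subset_terminal unfolding pd_outcome_def terminal_iff
  by metis

lemma Obs_subset_pverts: "Obs H T \<subseteq> pverts H"
proof (rule Obs_least)
  have sub: "closed_nbhd H X \<subseteq> pverts H" if "X \<subseteq> pverts H" for X
    using that pair_graph_arcs_subset[OF H] by (auto simp: closed_nbhd_def)
  then show "closed_nbhd H T \<subseteq> pverts H" using T .
  show "terminal H (pverts H)"
    unfolding terminal_def using sub by (metis Diff_eq_empty_iff empty_subsetI insert_not_empty insert_subset)
qed

end

section \<open>Blocking sensor-free vertices by pairs of private leaves\<close>

definition anchored :: "'a pair_pre_digraph \<Rightarrow> 'a set \<Rightarrow> bool" where
  "anchored H S \<longleftrightarrow> (\<forall>s\<in>S. \<exists>l1 l2. l1 \<noteq> l2 \<and> l1 \<notin> S \<and> l2 \<notin> S \<and>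
     parcs H `` {l1} = {s} \<and> parcs H `` {l2} = {s})"

text \<open>The leaves can only be reached through \<open>s\<close>, and \<open>s\<close> always
  misses both of them, never exactly one. Formally, deleting both leaves from \<open>Obs H T\<close>
  leaves a terminal set that still contains \<open>closed_nbhd H T\<close>, so minimality excludes
  them.\<close>

lemma leaves_not_observed:
  assumes H: "pair_graph H" and T: "T \<subseteq> pverts H"
    and s: "s \<notin> T" and l: "l1 \<noteq> l2" "l1 \<notin> T" "l2 \<notin> T"
    and n: "parcs H `` {l1} = {s}" "parcs H `` {l2} = {s}"
  shows "l1 \<notin> Obs H T" "l2 \<notin> Obs H T"
proof -
  let ?B = "Obs H T - {l1, l2}"
  have nbr: "(v, l1) \<in> parcs H \<longleftrightarrow> v = s" "(v, l2) \<in> parcs H \<longleftrightarrow> v = s" for v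
    using n pair_graph_sym[OF H] by blast+
  have "Obs H T \<subseteq> ?B"
  proof (rule Obs_least[OF H T])
    have "l1 \<notin> closed_nbhd H T" "l2 \<notin> closed_nbhd H T"
      using nbr s l by (auto simp: closed_nbhd_def)
    then show "closed_nbhd H T \<subseteq> ?B" using closed_nbhd_Obs[OF H T] by blast
    show "terminal H ?B"
      unfolding terminal_def
    proof (intro ballI allI notI)
      fix v u assume v: "v \<in> ?B" and u: "closed_nbhd H {v} - ?B = {u}"
      show False
      proof (cases "v = s")
        case True
        then have "{l1, l2} \<subseteq> closed_nbhd H {v} - ?B" using nbr by (auto simp: closed_nbhd_def)
        with u l(1) show False by auto
      next
        case False
        with v nbr have "l1 \<notin> closed_nbhd H {v}" "l2 \<notin> closed_nbhd H {v}"
          by (auto simp: closed_nbhd_def)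
        with u have "closed_nbhd H {v} - Obs H T = {u}" by blast
        with v terminal_Obs[OF H T] show False by (auto simp: terminal_def)
      qed
    qed
  qed
  then show "l1 \<notin> Obs H T" "l2 \<notin> Obs H T" by auto
qed

lemma ex_anchored:
  fixes G :: "'a pair_pre_digraph"
  assumes inf: "infinite (UNIV :: 'a set)" and G: "pair_graph G" and S: "S \<subseteq> pverts G"
  shows "\<exists>H. pair_graph H \<and> induced_subgraph (with_proj G) (with_proj H) \<and> anchored H S"
proof -
  have finV: "finite (pverts G)" by (rule pair_graph_finite_verts[OF G])
  then have finS: "finite (S \<times> (UNIV :: bool set))" using S finite_subset[OF S] by simp
  from inf finV have "infinite (- pverts G)" by (simp add: Compl_eq_Diff_UNIV)
  then obtain B where B: "finite B" "card B = card (S \<times> (UNIV :: bool set))" "B \<subseteq> - pverts G"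
    using infinite_arbitrarily_large by metis
  \<comment> \<open>The two leaves of \<open>s\<close> are \<open>g (s, True)\<close> and
    \<open>g (s, False)\<close>.\<close>
  obtain g where g: "g ` (S \<times> (UNIV :: bool set)) \<subseteq> B" "inj_on g (S \<times> UNIV)"
    using card_le_inj[OF finS B(1)] B(2) by auto
  define W where "W = g ` (S \<times> (UNIV :: bool set))"
  define E where "E = {(s, g (s, b)) | s b. s \<in> S}"
  let ?H = "extend_graph G W E"
  have new: "g (s, b) \<notin> pverts G" if "s \<in> S" for s b using that g(1) B(3) by auto
  have W: "finite W" "W \<inter> pverts G = {}" using finS g(1) B(3) by (auto simp: W_def)
  have E: "E \<subseteq> (pverts G \<union> W) \<times> W" "irrefl E"
    using S new by (auto simp: E_def W_def irrefl_def) (metis in_mono)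
  have "parcs ?H `` {g (s, b)} = {s}" if "s \<in> S" for s b
    using that new[OF that] S pair_graph_arcs_subset[OF G] g(2) new
    by (auto simp: E_def inj_on_def) blast+
  moreover have "g (s, True) \<noteq> g (s, False)" if "s \<in> S" for s
    using that g(2) by (auto simp: inj_on_def)
  ultimately have "anchored ?H S"
    unfolding anchored_def using new S by (metis in_mono)
  with pair_graph_extend[OF G W(1) E] induced_subgraph_extend[OF G W(1) E W(2)]
  show ?thesis by blast
qed

section \<open>The gadget and its observed vertices\<close>

lemma ex_five_fresh:
  fixes V :: "'a set"
  assumes "infinite (UNIV :: 'a set)" "finite V"
  shows "\<exists>y l1 l2 x z. distinct [y, l1, l2, x, z] \<and> {y, l1, l2, x, z} \<inter> V = {}"
proof -
  have ex: "\<exists>v. v \<notin> U" if "finite U" for U :: "'a set"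
    using ex_new_if_finite[OF assms(1) that] .
  obtain y where y: "y \<notin> V" using ex assms(2) by blast
  obtain l1 where l1: "l1 \<notin> insert y V" using ex assms(2) by blast
  obtain l2 where l2: "l2 \<notin> {l1, y} \<union> V" using ex assms(2) by (meson finite.simps finite_UnI)
  obtain x where x: "x \<notin> {l2, l1, y} \<union> V" using ex assms(2) by (meson finite.simps finite_UnI)
  obtain z where z: "z \<notin> {x, l2, l1, y} \<union> V" using ex assms(2) by (meson finite.simps finite_UnI)
  from y l1 l2 x z have "distinct [y, l1, l2, x, z] \<and> {y, l1, l2, x, z} \<inter> V = {}" by auto
  then show ?thesis by blast
qed

text \<open>
  The new vertex \<open>y\<close> is joined to \<open>A\<close> and blocked by its leaves \<open>l1, l2\<close>; \<open>x\<close> is joined to \<open>D\<close>, \<open>y\<close>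
  and \<open>z\<close>, so that \<open>z\<close> is forced (by \<open>x\<close>) exactly when both \<open>A\<close> and \<open>D\<close> contain a working sensor.
  The set \<open>D\<close> has at most one element; for \<open>D = {}\<close> neither \<open>x\<close> nor \<open>z\<close> is ever observed.
\<close>

locale gadget =
  fixes H :: "'a pair_pre_digraph" and S A D :: "'a set" and a y l1 l2 x z :: 'a
  assumes H: "pair_graph H" and S: "S \<subseteq> pverts H" and anch: "anchored H S"
    and A: "A \<subseteq> S" and D: "D \<subseteq> S" and Da: "D \<subseteq> {a}"
    and dist: "distinct [y, l1, l2, x, z]" and fresh: "{y, l1, l2, x, z} \<inter> pverts H = {}"
begin

definition W where "W = {y, l1, l2, x, z}"

definition E where "E = A \<times> {y} \<union> D \<times> {x} \<union> {(y, l1), (y, l2), (y, x), (x, z)}"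

abbreviation H' where "H' \<equiv> extend_graph H W E"

lemma W: "finite W" "W \<inter> pverts H = {}"
  using fresh by (auto simp: W_def)

lemma E: "E \<subseteq> (pverts H \<union> W) \<times> W" "irrefl E"
proof -
  have AD: "A \<subseteq> pverts H" "D \<subseteq> pverts H" using A D S by simp_all
  have yl: "{(y, l1), (y, l2), (y, x), (x, z)} \<subseteq> W \<times> W" by (simp add: W_def)
  have yx: "y \<in> W" "x \<in> W" by (simp_all add: W_def)
  show "E \<subseteq> (pverts H \<union> W) \<times> W"
    unfolding E_def using AD yl yx by (intro Un_least) blast+
  have "y \<notin> A" "x \<notin> D" using AD fresh by blast+
  with dist show "irrefl E" unfolding irrefl_def E_def by (intro allI) auto
qed

lemma H': "pair_graph H'"
  by (rule pair_graph_extend[OF H W(1) E])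

lemma induced: "induced_subgraph (with_proj H) (with_proj H')"
  by (rule induced_subgraph_extend[OF H W(1) E W(2)])

lemma old_arcs: "(u, v) \<in> parcs H \<Longrightarrow> u \<in> pverts H \<and> v \<in> pverts H"
  using pair_graph_arcs_subset[OF H] by auto

lemma not_old: "y \<notin> pverts H" "l1 \<notin> pverts H" "l2 \<notin> pverts H" "x \<notin> pverts H" "z \<notin> pverts H"
  using fresh by auto

lemma nbhd_y: "closed_nbhd H' {y} = {y, l1, l2, x} \<union> A"
  using old_arcs not_old dist A D S by (auto simp: closed_nbhd_def E_def)

lemma nbhd_x: "closed_nbhd H' {x} = {x, y, z} \<union> D"
  using old_arcs not_old dist A D S by (auto simp: closed_nbhd_def E_def)

lemma nbhd_z: "closed_nbhd H' {z} = {z, x}"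
  using old_arcs not_old dist A D S by (auto simp: closed_nbhd_def E_def)

lemma nbhd_old:
  "v \<in> pverts H \<Longrightarrow> closed_nbhd H' {v} =
     closed_nbhd H {v} \<union> (if v \<in> A then {y} else {}) \<union> (if v \<in> D then {x} else {})"
  using not_old by (auto simp: closed_nbhd_def E_def)

lemma nbhd_T:
  "T \<subseteq> S \<Longrightarrow> closed_nbhd H' T =
     closed_nbhd H T \<union> (if T \<inter> A \<noteq> {} then {y} else {}) \<union> (if T \<inter> D \<noteq> {} then {x} else {})"
  using not_old S by (auto simp: closed_nbhd_def E_def)

lemma closed_nbhd_old: "X \<subseteq> pverts H \<Longrightarrow> closed_nbhd H X \<subseteq> pverts H"
  using old_arcs by (auto simp: closed_nbhd_def)

text \<open>The leaves guarding \<open>S\<close> lie outside \<open>S\<close> and gain no neighbour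
  from the gadget. Hence further gadgets can be attached to \<open>H'\<close>.\<close>

lemma anchored': "anchored H' S"
  unfolding anchored_def
proof
  fix s assume s: "s \<in> S"
  with anch obtain m1 m2 where m: "m1 \<noteq> m2" "m1 \<notin> S" "m2 \<notin> S"
      "parcs H `` {m1} = {s}" "parcs H `` {m2} = {s}"
    by (auto simp: anchored_def)
  have "parcs H' `` {m} = parcs H `` {m}" if "m \<notin> S" "m \<in> pverts H" for m
    using that A D not_old by (auto simp: E_def)
  moreover have "m1 \<in> pverts H" "m2 \<in> pverts H" using m old_arcs by blast+
  ultimately show "\<exists>l1 l2. l1 \<noteq> l2 \<and> l1 \<notin> S \<and> l2 \<notin> S \<and>
      parcs H' `` {l1} = {s} \<and> parcs H' `` {l2} = {s}"
    using m by metis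
qed

definition X where
  "X T = (if T \<inter> A \<noteq> {} then {y} else {}) \<union> (if T \<inter> D \<noteq> {} then {x} else {}) \<union>
     (if T \<inter> A \<noteq> {} \<and> T \<inter> D \<noteq> {} then {z} else {})"

context
  fixes T assumes T: "T \<subseteq> S"
begin

lemma TV: "T \<subseteq> pverts H" "T \<subseteq> pverts H'"
  using T S by auto

lemma X_new: "X T \<inter> pverts H = {}" "l1 \<notin> X T" "l2 \<notin> X T"
  using not_old dist by (auto simp: X_def)

lemma ex_unobserved_leaves:
  assumes "s \<in> S" "s \<notin> T"
  shows "\<exists>m1 m2. m1 \<noteq> m2 \<and> {m1, m2} \<subseteq> closed_nbhd H {s} - Obs H T"
proof -
  from anch assms obtain m1 m2 where m: "m1 \<noteq> m2" "m1 \<notin> S" "m2 \<notin> S"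
      "parcs H `` {m1} = {s}" "parcs H `` {m2} = {s}"
    by (auto simp: anchored_def)
  have "m1 \<notin> Obs H T" "m2 \<notin> Obs H T"
    using leaves_not_observed[OF H TV(1) assms(2) m(1) _ _ m(4,5)] m(2,3) T by auto
  moreover have "m1 \<in> closed_nbhd H {s}" "m2 \<in> closed_nbhd H {s}"
    using m(4,5) pair_graph_sym[OF H] by (auto simp: closed_nbhd_def)
  ultimately show ?thesis using m(1) by blast
qed

text \<open>This is where \<open>D\<close> having at most one element matters: as soon as
  \<open>x\<close> is observed from a sensor in \<open>D\<close>, all old neighbours of
  \<open>x\<close> are observed, and only \<open>y\<close> and \<open>z\<close> can be
  missing.\<close>

lemma D_subset: "T \<inter> D \<noteq> {} \<Longrightarrow> D \<subseteq> T"
  using Da by auto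

text \<open>Both inclusions follow from minimality: the right-hand side is terminal in
  \<open>H'\<close>, and the old part of \<open>Obs H' T\<close> is terminal in \<open>H\<close>.
  The gadget meets old vertices only in \<open>S\<close>. Those in \<open>T\<close> have their whole
  neighborhood observed at the start, the others are stuck at two leaves, and outside
  \<open>S\<close> old neighborhoods are unchanged.\<close>

lemma Obs_gadget: "Obs H' T = Obs H T \<union> X T"
proof
  let ?B = "Obs H T"
  note BV = Obs_subset_pverts[OF H TV(1)] and NB = closed_nbhd_Obs[OF H TV(1)]
  have TB: "T \<subseteq> ?B" using NB by (auto simp: closed_nbhd_def)
  have NBX: "closed_nbhd H' T \<subseteq> ?B \<union> X T"
    using NB unfolding nbhd_T[OF T] X_def by auto
  show sub: "Obs H' T \<subseteq> ?B \<union> X T"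
  proof (rule Obs_least[OF H' TV(2) NBX], unfold terminal_def, intro ballI allI notI)
    fix v u assume v: "v \<in> ?B \<union> X T" and u: "closed_nbhd H' {v} - (?B \<union> X T) = {u}"
    from v consider "v \<in> T" | "v \<in> ?B" "v \<in> S" "v \<notin> T" | "v \<in> ?B" "v \<notin> S" | "v = y"
      | "v = x" "T \<inter> D \<noteq> {}" | "v = z" "T \<inter> D \<noteq> {}" "T \<inter> A \<noteq> {}"
      by (auto simp: X_def split: if_splits)
    then show False
    proof cases
      case 1
      then show ?thesis using u NBX closed_nbhd_subset[of v T H'] by blast
    next
      case 2
      then obtain m1 m2 where m: "m1 \<noteq> m2" "{m1, m2} \<subseteq> closed_nbhd H {v} - ?B"
        using ex_unobserved_leaves by blast
      moreover have "closed_nbhd H {v} \<subseteq> pverts H" using 2 BV by (intro closed_nbhd_old) auto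
      moreover have "closed_nbhd H {v} \<subseteq> closed_nbhd H' {v}" using nbhd_old[OF subsetD[OF BV 2(1)]] by auto
      ultimately have "{m1, m2} \<subseteq> closed_nbhd H' {v} - (?B \<union> X T)"
        using X_new(1) by blast
      with u m(1) show ?thesis by auto
    next
      case 3
      then have "closed_nbhd H {v} \<subseteq> pverts H" using BV by (intro closed_nbhd_old) auto
      moreover have "closed_nbhd H' {v} = closed_nbhd H {v}"
        using 3 A D nbhd_old[OF subsetD[OF BV 3(1)]] by auto
      ultimately have "closed_nbhd H {v} - ?B = {u}" using u X_new(1) by blast
      with 3 terminal_Obs[OF H TV(1)] show ?thesis by (auto simp: terminal_def)
    next
      case 4
      \<comment> \<open>The leaves \<open>l1\<close> and \<open>l2\<close> keep \<open>y\<close>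
        from forcing into \<open>A\<close> or to \<open>x\<close>.\<close>
      then have "{l1, l2} \<subseteq> closed_nbhd H' {v} - (?B \<union> X T)"
        using nbhd_y X_new BV not_old by auto
      with u dist show ?thesis by auto
    next
      case 5
      have D: "D \<subseteq> ?B" using D_subset[OF 5(2)] TB by auto
      show ?thesis
      proof (cases "T \<inter> A = {}")
        case True
        \<comment> \<open>Without a working sensor in \<open>A\<close>, the vertex \<open>x\<close>
          misses both \<open>y\<close> and \<open>z\<close> and cannot force.\<close>
        then have "{y, z} \<subseteq> closed_nbhd H' {v} - (?B \<union> X T)"
          using 5 nbhd_x BV not_old dist by (auto simp: X_def)
        with u dist show ?thesis by auto
      next
        case False
        with 5 D have "closed_nbhd H' {v} \<subseteq> ?B \<union> X T" using nbhd_x by (auto simp: X_def)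
        with u show ?thesis by auto
      qed
    next
      case 6
      then have "closed_nbhd H' {v} \<subseteq> ?B \<union> X T" using nbhd_z by (auto simp: X_def)
      with u show ?thesis by auto
    qed
  qed
  let ?C = "Obs H' T"
  note NC = closed_nbhd_Obs[OF H' TV(2)]
  have TC: "T \<subseteq> ?C" using NC by (auto simp: closed_nbhd_def)
  have "?B \<subseteq> ?C \<inter> pverts H"
  proof (rule Obs_least[OF H TV(1)])
    show "closed_nbhd H T \<subseteq> ?C \<inter> pverts H"
      using NC closed_nbhd_old[OF TV(1)] nbhd_T[OF T] by auto
    show "terminal H (?C \<inter> pverts H)"
      unfolding terminal_def
    proof (intro ballI allI notI)
      fix v u assume v: "v \<in> ?C \<inter> pverts H" and u: "closed_nbhd H {v} - (?C \<inter> pverts H) = {u}"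
      \<comment> \<open>The inclusion already proved carries the unobserved leaves over from
        \<open>Obs H T\<close> to \<open>?C\<close>.\<close>
      have CB: "?C \<inter> pverts H \<subseteq> ?B" using sub X_new(1) by blast
      consider "v \<in> T" | "v \<in> S" "v \<notin> T" | "v \<notin> S" by blast
      then show False
      proof cases
        case 1
        then have "closed_nbhd H {v} \<subseteq> ?C \<inter> pverts H"
          using NC closed_nbhd_old[OF TV(1)] nbhd_T[OF T] closed_nbhd_subset[of v T H] by auto
        with u show ?thesis by auto
      next
        case 2
        then obtain m1 m2 where m: "m1 \<noteq> m2" "{m1, m2} \<subseteq> closed_nbhd H {v} - ?B"
          using ex_unobserved_leaves by blast
        with CB have "{m1, m2} \<subseteq> closed_nbhd H {v} - (?C \<inter> pverts H)" by blast
        with u m(1) show ?thesis by auto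
      next
        case 3
        have "closed_nbhd H {v} \<subseteq> pverts H" using v by (intro closed_nbhd_old) auto
        moreover have "closed_nbhd H' {v} = closed_nbhd H {v}"
          using 3 A D nbhd_old[of v] v by auto
        ultimately have "closed_nbhd H' {v} - ?C = {u}" using u by blast
        with v terminal_Obs[OF H' TV(2)] show ?thesis by (auto simp: terminal_def)
      qed
    qed
  qed
  moreover have yC: "y \<in> ?C" if "T \<inter> A \<noteq> {}" using that NC nbhd_T[OF T] by auto
  moreover have xC: "x \<in> ?C" if "T \<inter> D \<noteq> {}" using that NC nbhd_T[OF T] by auto
  moreover have "z \<in> ?C" if "T \<inter> A \<noteq> {}" "T \<inter> D \<noteq> {}"
  proof (rule ccontr)
    assume "z \<notin> ?C"
    then have "closed_nbhd H' {x} - ?C = {z}"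
      unfolding nbhd_x using yC[OF that(1)] xC[OF that(2)] D_subset[OF that(2)] TC by auto
    with xC[OF that(2)] terminal_Obs[OF H' TV(2)] show False by (auto simp: terminal_def)
  qed
  ultimately show "?B \<union> X T \<subseteq> ?C" by (auto simp: X_def)
qed

text \<open>With \<open>b K\<close> the indicator of \<open>T\<close> avoiding \<open>K\<close>, the
  vertices \<open>y\<close>, \<open>x\<close>, \<open>z\<close> contribute \<open>1 - b A\<close>,
  \<open>1 - b D\<close> and \<open>(1 - b A) * (1 - b D)\<close>, where
  \<open>b A * b D = b (A \<union> D)\<close>. Avoidance indicators are used because each has a
  single power of \<open>q\<close> as its expectation.\<close>

lemma card_Obs_gadget:
  "int (card (Obs H' T)) = int (card (Obs H T)) + 3 - 2 * of_bool (T \<inter> A = {})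
     - 2 * of_bool (T \<inter> D = {}) + of_bool (T \<inter> (A \<union> D) = {})"
proof -
  have "finite (Obs H T)" "Obs H T \<inter> X T = {}"
    using Obs_subset_pverts[OF H TV(1)] pair_graph_finite_verts[OF H] finite_subset X_new(1) by auto
  moreover have "finite (X T)" by (simp add: X_def)
  ultimately have "card (Obs H' T) = card (Obs H T) + card (X T)"
    using Obs_gadget card_Un_disjoint by metis
  moreover have "int (card (X T)) = 3 - 2 * of_bool (T \<inter> A = {})
     - 2 * of_bool (T \<inter> D = {}) + of_bool (T \<inter> (A \<union> D) = {})"
    using dist by (auto simp: X_def Int_Un_distrib)
  ultimately show ?thesis by simp
qed

end

end

section \<open>Expectation over sensor failures\<close>

definition outcome_weight :: "'a multiset \<Rightarrow> 'a set \<Rightarrow> int poly" where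
  "outcome_weight M T = monom 1 (\<Sum>s\<in>set_mset M - T. count M s) * (\<Prod>s\<in>T. 1 - monom 1 (count M s))"

lemma prod_monom_1: "(\<Prod>s\<in>A. monom (1 :: int) (n s)) = monom 1 (sum n A)"
  by (induction A rule: infinite_finite_induct) (auto simp: mult_monom)

text \<open>The left-hand side is the probability that all sensors at \<open>A\<close> fail.\<close>

lemma sum_outcome_weight_avoiding:
  assumes "A \<subseteq> set_mset M"
  shows "(\<Sum>T\<in>Pow (set_mset M). of_bool (T \<inter> A = {}) * outcome_weight M T) = monom 1 (sum (count M) A)"
proof -
  let ?S = "set_mset M"
  \<comment> \<open>Setting the factor to 0 on \<open>A\<close> encodes the indicator. The sum over
    subsets then becomes a product of \<open>?p s + ?r s\<close>, which is \<open>?r s\<close> on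
    \<open>A\<close> and 1 elsewhere.\<close>
  let ?p = "\<lambda>s. if s \<in> A then 0 else 1 - monom (1 :: int) (count M s)"
  let ?r = "\<lambda>s. monom (1 :: int) (count M s)"
  have "of_bool (T \<inter> A = {}) * outcome_weight M T = prod ?p T * prod ?r (?S - T)"
    if "T \<subseteq> ?S" for T
  proof (cases "T \<inter> A = {}")
    case True
    then have "prod ?p T = (\<Prod>s\<in>T. 1 - ?r s)" by (intro prod.cong) auto
    with True show ?thesis by (simp add: outcome_weight_def prod_monom_1)
  next
    case False
    moreover have "finite T" using that finite_subset by auto
    ultimately have "prod ?p T = 0" by (auto intro!: prod_zero)
    with False show ?thesis by simp
  qed
  then have "(\<Sum>T\<in>Pow ?S. of_bool (T \<inter> A = {}) * outcome_weight M T)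
      = (\<Sum>T\<in>Pow ?S. prod ?p T * prod ?r (?S - T))"
    by (intro sum.cong) auto
  also have "\<dots> = (\<Prod>s\<in>?S. ?p s + ?r s)" by (simp add: prod_add)
  also have "\<dots> = (\<Prod>s\<in>?S. if s \<in> A then ?r s else 1)" by (intro prod.cong) auto
  also have "\<dots> = prod ?r (?S \<inter> A)" by (simp add: prod.inter_restrict)
  also have "?S \<inter> A = A" using assms by auto
  finally show ?thesis by (simp add: prod_monom_1)
qed

lemma expected_poly_outcome_weight:
  "expected_poly H M = (\<Sum>T\<in>Pow (set_mset M). of_int (int (card (Obs H T))) * outcome_weight M T)"
  by (simp add: expected_poly_def outcome_weight_def mult.assoc)

text \<open>Linearity of expectation: \<open>outcome_weight M T\<close> is the probability that
  exactly the vertices of \<open>T\<close> keep a working sensor.\<close>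

lemma (in gadget) expected_poly_gadget:
  assumes M: "set_mset M = S"
  shows "expected_poly H' M = expected_poly H M + 3 - 2 * monom 1 (sum (count M) A)
           - 2 * monom 1 (sum (count M) D) + monom 1 (sum (count M) (A \<union> D))"
proof -
  let ?w = "outcome_weight M"
  let ?b = "\<lambda>K T. of_bool (T \<inter> K = {}) :: int poly"
  have sub: "{} \<subseteq> set_mset M" "A \<subseteq> set_mset M" "D \<subseteq> set_mset M" "A \<union> D \<subseteq> set_mset M"
    using A D M by auto
  \<comment> \<open>The constant 3 is written as three times the indicator of avoiding the empty
    set, so that all terms are averaged by the same lemma.\<close>
  have "expected_poly H' M = (\<Sum>T\<in>Pow (set_mset M). of_int (int (card (Obs H T))) * ?w T
      + 3 * (?b {} T * ?w T) - 2 * (?b A T * ?w T) - 2 * (?b D T * ?w T) + ?b (A \<union> D) T * ?w T)"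
    unfolding expected_poly_outcome_weight
  proof (intro sum.cong refl)
    fix T assume "T \<in> Pow (set_mset M)"
    with M have "T \<subseteq> S" by auto
    then show "of_int (int (card (Obs H' T))) * ?w T = of_int (int (card (Obs H T))) * ?w T
      + 3 * (?b {} T * ?w T) - 2 * (?b A T * ?w T) - 2 * (?b D T * ?w T) + ?b (A \<union> D) T * ?w T"
      unfolding card_Obs_gadget[OF \<open>T \<subseteq> S\<close>] by (simp add: algebra_simps)
  qed
  also have "\<dots> = expected_poly H M + 3 * (\<Sum>T\<in>Pow (set_mset M). ?b {} T * ?w T)
      - 2 * (\<Sum>T\<in>Pow (set_mset M). ?b A T * ?w T) - 2 * (\<Sum>T\<in>Pow (set_mset M). ?b D T * ?w T)
      + (\<Sum>T\<in>Pow (set_mset M). ?b (A \<union> D) T * ?w T)"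
    by (simp only: sum.distrib sum_subtractf sum_distrib_left expected_poly_outcome_weight)
  also have "\<dots> = expected_poly H M + 3 * monom 1 0 - 2 * monom 1 (sum (count M) A)
      - 2 * monom 1 (sum (count M) D) + monom 1 (sum (count M) (A \<union> D))"
    using sum_outcome_weight_avoiding[OF sub(1)]
    by (simp only: sum_outcome_weight_avoiding sub sum.empty)
  finally show ?thesis by (simp add: one_poly_eq_simps flip: monom_eq_1)
qed

section \<open>Adjusting single coefficients\<close>

definition realizable :: "'a pair_pre_digraph \<Rightarrow> 'a multiset \<Rightarrow> int poly \<Rightarrow> bool" where
  "realizable G M p \<longleftrightarrow> (\<exists>H. pair_graph H \<and> induced_subgraph (with_proj G) (with_proj H) \<and>
     anchored H (set_mset M) \<and> expected_poly H M = p)"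

lemma realizable_gadget:
  fixes G :: "'a pair_pre_digraph"
  assumes inf: "infinite (UNIV :: 'a set)" and M: "set_mset M \<subseteq> pverts G"
    and p: "realizable G M p" and AD: "A \<subseteq> set_mset M" "D \<subseteq> set_mset M" "D \<subseteq> {a}"
  shows "realizable G M (p + 3 - 2 * monom 1 (sum (count M) A) - 2 * monom 1 (sum (count M) D)
           + monom 1 (sum (count M) (A \<union> D)))"
proof -
  from p obtain H where Hp: "pair_graph H" "induced_subgraph (with_proj G) (with_proj H)"
      "anchored H (set_mset M)" "expected_poly H M = p"
    by (auto simp: realizable_def)
  have "set_mset M \<subseteq> pverts H"
    using M Hp(2) by (auto simp: induced_subgraph_def subgraph_def)
  moreover obtain y l1 l2 x z where "distinct [y, l1, l2, x, z]"
      "{y, l1, l2, x, z} \<inter> pverts H = {}"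
    using ex_five_fresh[OF inf pair_graph_finite_verts[OF Hp(1)]] by blast
  ultimately interpret gadget H "set_mset M" A D a y l1 l2 x z
    by (intro gadget.intro Hp AD)
  show ?thesis
    unfolding realizable_def
    using H' induced_subgraph_trans[OF Hp(2) induced] anchored' expected_poly_gadget Hp(4) by blast
qed

text \<open>From degree \<open>u + v\<close> on, only the last monomial is visible: the constant has
  degree 0, and \<open>u\<close> and \<open>v\<close> are both strictly below
  \<open>u + v\<close>.\<close>

lemma coeff_increment:
  fixes p :: "int poly"
  assumes "0 < u" "0 < v" "u + v \<le> j"
  shows "coeff (p + 3 - 2 * monom 1 u - 2 * monom 1 v + monom 1 (v + u)) j
    = coeff p j + of_bool (j = u + v)"
proof -
  have two: "2 * monom (1 :: int) n = monom 2 n" for n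
    using add_monom[of "1::int" n 1] by (simp only: mult_2 one_add_one)
  have three: "coeff (3 :: int poly) j = 0"
    using assms by (simp add: numeral_poly coeff_pCons split: nat.split)
  show ?thesis using assms unfolding two coeff_add coeff_diff three coeff_monom
    by auto
qed

context
  fixes G :: "'a pair_pre_digraph" and M :: "'a multiset"
  assumes inf: "infinite (UNIV :: 'a set)" and M: "set_mset M \<subseteq> pverts G"
begin

lemma realizable_decr:
  assumes p: "realizable G M p" and A: "A \<subseteq> set_mset M"
  shows "realizable G M (p + 1 - monom 1 (sum (count M) A))"
proof -
  \<comment> \<open>For \<open>D = {}\<close> the third monomial is \<open>monom 1 0 = 1\<close> and
    the two monomials of \<open>A\<close> combine.\<close>
  have eq: "p + 3 - 2 * monom 1 (sum (count M) A) - 2 * monom 1 (sum (count M) {})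
      + monom 1 (sum (count M) (A \<union> {})) = p + 1 - monom 1 (sum (count M) A)"
    by simp
  show ?thesis
    using realizable_gadget[OF inf M p A empty_subsetI empty_subsetI] unfolding eq .
qed

text \<open>The coefficient is moved in unit steps from its value in \<open>p\<close> to
  \<open>d\<close>: upwards by the gadget splitting \<open>A\<close> into \<open>A - {a}\<close> and
  \<open>{a}\<close>, downwards by the gadget with \<open>D = {}\<close>.\<close>

lemma realizable_shift_coeff:
  assumes p: "realizable G M p" and A: "A \<subseteq> set_mset M" "card A \<ge> 2"
  shows "\<exists>p'. realizable G M p' \<and> coeff p' (sum (count M) A) = d \<and>
           (\<forall>j > sum (count M) A. coeff p' j = coeff p j)"
proof -
  let ?k = "sum (count M) A"
  have pos: "0 < sum (count M) B" if "B \<subseteq> A" "B \<noteq> {}" for B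
  proof (rule sum_pos)
    show "finite B" using that A(1) by (meson finite_set_mset finite_subset order_trans)
    show "0 < count M s" if "s \<in> B" for s using that \<open>B \<subseteq> A\<close> A(1) by auto
  qed fact
  have k: "?k > 0" using A(2) pos[of A] by fastforce
  obtain a where a: "a \<in> A" using A(2) by fastforce
  have fin: "finite A" using A(1) by (meson finite_set_mset finite_subset)
  \<comment> \<open>Here \<open>card A \<ge> 2\<close> enters: both parts of \<open>A\<close> are
    nonempty, so both of their weights are positive and lie below \<open>?k\<close>.\<close>
  have "card (A - {a}) \<noteq> 0" using A(2) card_Diff_singleton[OF a] by linarith
  then have "A - {a} \<noteq> {}" by (metis card.empty)
  then have rest: "0 < sum (count M) (A - {a})" using pos[of "A - {a}"] by blast
  have split: "?k = count M a + sum (count M) (A - {a})"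
    using sum.remove[OF fin a] .
  have a0: "0 < count M a" using a A(1) by auto
  show ?thesis
  proof (induction d rule: int_induct[where k = "coeff p ?k"])
    case base
    then show ?case using p by blast
  next
    case (step1 d)
    then obtain p' where p': "realizable G M p'" "coeff p' ?k = d"
        "\<forall>j > ?k. coeff p' j = coeff p j"
      by blast
    let ?p = "p' + 3 - 2 * monom 1 (sum (count M) (A - {a})) - 2 * monom 1 (sum (count M) {a})
      + monom 1 (sum (count M) A)"
    have "A - {a} \<union> {a} = A" using a by auto
    then have "realizable G M ?p"
      using realizable_gadget[OF inf M p'(1), of "A - {a}" "{a}" a] A(1) a by auto
    moreover have "coeff ?p j = coeff p' j + of_bool (j = ?k)" if "?k \<le> j" for j
      using coeff_increment[OF rest a0, of j p'] that split by (simp add: add.commute)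
    then have "coeff ?p ?k = d + 1" "\<forall>j > ?k. coeff ?p j = coeff p j"
      using p'(2,3) by (simp_all del: coeff_add coeff_diff)
    ultimately show ?case by blast
  next
    case (step2 d)
    then obtain p' where p': "realizable G M p'" "coeff p' ?k = d"
        "\<forall>j > ?k. coeff p' j = coeff p j"
      by blast
    have "coeff (p' + 1 - monom 1 ?k) ?k = d - 1"
      "\<forall>j > ?k. coeff (p' + 1 - monom 1 ?k) j = coeff p j"
      using p' k by auto
    with realizable_decr[OF p'(1) A(1)] show ?case by blast
  qed
qed

end

theorem theorem2p6:
  fixes G :: "'a pair_pre_digraph" and S :: "'a set" and f :: "'a \<Rightarrow> nat"
    and M :: "'a multiset" and c :: "nat \<Rightarrow> int"
  assumes "infinite (UNIV :: 'a set)"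
    and "pair_graph G"
    and "S \<subseteq> pverts G"
    and "\<And>s. s \<in> S \<Longrightarrow> f s \<ge> 1"
    and "set_mset M = S"
    and "\<And>s. s \<in> S \<Longrightarrow> count M s = f s"
  shows "\<exists>G' :: 'a pair_pre_digraph.
           pair_graph G' \<and>
           induced_subgraph (with_proj G) (with_proj G') \<and>
           (\<forall>k \<in> R2 S f. coeff (expected_poly G' M) k = c k)"
proof -
  have M: "set_mset M \<subseteq> pverts G" using assms(3,5) by simp
  have R2: "\<exists>A\<subseteq>set_mset M. card A \<ge> 2 \<and> k = sum (count M) A" if k: "k \<in> R2 S f" for k
  proof -
    obtain A where "A \<subseteq> S" "card A \<ge> 2" "k = sum f A"
      using k by (auto simp: R2_def)
    moreover have "sum f A = sum (count M) A"
      using assms(6) \<open>A \<subseteq> S\<close> by (intro sum.cong) auto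
    ultimately show ?thesis using assms(5) by auto
  qed
  \<comment> \<open>downward induction on \<open>k\<close>, since adjusting one coefficient disturbs the lower ones\<close>
  have "\<exists>p. realizable G M p \<and> (\<forall>k\<in>R2 S f. k + m > sum f S \<longrightarrow> coeff p k = c k)" for m
  proof (induction m)
    case 0
    \<comment> \<open>No coefficient is prescribed for \<open>m = 0\<close>, so the anchored
      extension of \<open>G\<close> serves as the start.\<close>
    have "k \<le> sum f S" if "k \<in> R2 S f" for k
      using that assms(5) by (auto simp: R2_def intro!: sum_mono2)
    moreover obtain p where "realizable G M p"
      using ex_anchored[OF assms(1,2) M] by (auto simp: realizable_def)
    ultimately show ?case by (metis add.right_neutral not_le)
  next
    case (Suc m)
    then obtain p where p: "realizable G M p" "\<forall>k\<in>R2 S f. k + m > sum f S \<longrightarrow> coeff p k = c k"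
      by blast
    show ?case
    proof (cases "\<exists>k\<in>R2 S f. k + m = sum f S")
      case False
      then have "\<forall>k\<in>R2 S f. k + Suc m > sum f S \<longrightarrow> k + m > sum f S"
        by (metis add_Suc_right less_SucE)
      with p show ?thesis by blast
    next
      case True
      then obtain k where k: "k \<in> R2 S f" "k + m = sum f S" by blast
      \<comment> \<open>Several subsets may have the same weight \<open>k\<close>. Any one of them
        will do, since only the coefficient at \<open>k\<close> has to be set.\<close>
      from R2[OF k(1)] obtain A where A: "A \<subseteq> set_mset M" "card A \<ge> 2" "k = sum (count M) A"
        by blast
      obtain p' where p': "realizable G M p'" "coeff p' k = c k" "\<forall>j > k. coeff p' j = coeff p j"
        using realizable_shift_coeff[OF assms(1) M p(1) A(1,2)] A(3) by blast
      have "coeff p' j = c j" if "j \<in> R2 S f" "j + Suc m > sum f S" for j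
        using that p(2) p'(2,3) k by (cases "j = k") auto
      with p'(1) show ?thesis by blast
    qed
  qed
  \<comment> \<open>For this \<open>m\<close> the bound holds for every \<open>k\<close>, including
    0.\<close>
  from this[of "Suc (sum f S)"] show ?thesis
    by (auto simp: realizable_def)
qed

end
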